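(* Let $h_1,\dots,h_{N_b}$ be finitely many spatial lag bins, let $\Lambda\subset\mathbb{R}^2$ be a parameter set of spatial kernel parameters $\rho_s=(\sigma_s,\lambda_s)$, let $\gamma(h;\rho_s)$ be a theoretical variogram model that is differentiable in $\rho_s$, and let $\rho_s^*=(\sigma_s^*,\lambda_s^* )\in\Lambda$ be the true parameters of the field in a fixed region, where the field is second-order stationary with constant spatial and temporal lengthscales. After $n$ concurrent sample pairs have been collected in the region, let $n_b=n_b(n)$ be the number of pairs whose lag lies in bin $b$, let $\hat\gamma_n(h_b)$ be the empirical semivariance of bin $b$, and let $$L_n(\rho_s)=\sum_{b=1}^{N_b}\bigl[\hat\gamma_n(h_b)-\gamma(h_b;\rho_s)\bigr]^2,\qquad \hat\rho_{s,n}=(\hat\sigma_{s,n},\hat\lambda_{s,n})\in\arg\min_{\rho_s\in\Lambda}L_n(\rho_s).$$ Assume: (i) for each bin $b$, $\hat\gamma_n(h_b)=\gamma(h_b;\rho_s^* )+\varepsilon_b$ with $\mathbb{E}[\varepsilon_b]=0$ and $\mathrm{Var}(\varepsilon_b)<\infty$; moreover $\mathbb{E}[\hat\gamma_n(h_b)]-\gamma(h_b;\rho_s^* )=\mathcal{O}(1/n_b)$ and $\mathrm{Var}(\varepsilon_b)=\mathcal{O}(1/n_b)$; (ii) as $n\to\infty$, $n_b\to\infty$ for each bin $b$, and there exist constants $c_b>0$ with $n_b/n\to c_b$; (iii) $\Lambda$ is compact; (iv) the map $\rho_s\mapsto(\gamma(h_1;\rho_s),\dots,\gamma(h_{N_b};\rho_s))$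 is injective on $\Lambda$; (v) the residuals $\varepsilon_b$ are uncorrelated across bins, and within each bin the sample pairs (hence their squared differences) are independent. Then, as $n\to\infty$, $$\hat\rho_{s,n}\xrightarrow{\mathrm{a.s.}}\rho_s^*\qquad\text{and hence}\qquad \hat\lambda_{s,n}\xrightarrow{\mathrm{a.s.}}\lambda_s^*.$$
   Context: A spatiotemporal field $f(t,p)$ is second-order stationary in a region if its mean is constant there and $\mathrm{Cov}(f(t,p),f(t+\Delta t,p+\Delta p))$ depends only on $(\Delta t,\Delta p)$. A concurrent sample pair consists of two measurements $(y^1,y^2)$ of the field taken at the same time at two locations $p^1,p^2$ of the region; its spatial lag is $\|p^1-p^2\|$. Bin $b$ is the lag interval $h_b=[(b-1)\epsilon,b\epsilon)$ of width $\epsilon>0$; when $h_b$ appears as an argument of $\gamma$ or $\hat\gamma_n$ it stands for the (fixed) lag value representing that bin. For a second-order stationary field $Z$ the theoretical variogram is $\gamma(d)=\tfrac12\mathbb{E}[(Z(a)-Z(a'))^2]$ with $d=\|a-a'\|$; here it is taken from a parametric family $\gamma(h;\rho_s)$, where $\rho_s=(\sigma_s,\lambda_s)$, $\sigma_s$ being the variance parameter and $\lambda_s$ the spatial lengthscale (for example a Matérn-1/2 model). With $N(h_b)$ the set of collected pairs with lag in bin $b$ and $n_b=|N(h_b)|$, the empirical semivariance is $$\hat\gamma_n(h_b)=\frac{1}{2n_b}\sum_{(y^1,y^2)\in N(h_b)}(y^1-y^2)^2 .$$ *)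

theory Defs
  imports "HOL-Probability.Probability"
begin

text \<open>
  A spatiotemporal field is a family \<open>Z t p\<close> of real random variables on a probability space
  \<open>M\<close>, indexed by a time \<open>t\<close> and a location \<open>p\<close>.  A region is a set of locations.
\<close>

definition covariance :: "'w measure \<Rightarrow> ('w \<Rightarrow> real) \<Rightarrow> ('w \<Rightarrow> real) \<Rightarrow> real" where
  "covariance M X Y =
     prob_space.expectation M
       (\<lambda>\<omega>. (X \<omega> - prob_space.expectation M X) * (Y \<omega> - prob_space.expectation M Y))"

text \<open>
  The first conjunct only says that means and covariances exist; otherwise the Bochner integral
  would silently take the value 0.
\<close>

definition second_order_stationary ::
    "'w measure \<Rightarrow> (real \<Rightarrow> 'p::euclidean_space \<Rightarrow> 'w \<Rightarrow> real) \<Rightarrow> 'p set \<Rightarrow> bool" where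
  "second_order_stationary M Z A \<longleftrightarrow>
     (\<forall>t. \<forall>p\<in>A. Z t p \<in> borel_measurable M \<and> integrable M (\<lambda>\<omega>. (Z t p \<omega>)\<^sup>2)) \<and>
     (\<exists>m. \<forall>t. \<forall>p\<in>A. prob_space.expectation M (Z t p) = m) \<and>
     (\<exists>C. \<forall>t p \<Delta>t \<Delta>p. p \<in> A \<longrightarrow> p + \<Delta>p \<in> A \<longrightarrow>
        covariance M (Z t p) (Z (t + \<Delta>t) (p + \<Delta>p)) = C \<Delta>t \<Delta>p)"

definition has_spatial_variogram ::
    "'w measure \<Rightarrow> (real \<Rightarrow> 'p::euclidean_space \<Rightarrow> 'w \<Rightarrow> real) \<Rightarrow> 'p set \<Rightarrow> (real \<Rightarrow> real) \<Rightarrow> bool" where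
  "has_spatial_variogram M Z A g \<longleftrightarrow>
     (\<forall>t. \<forall>p\<in>A. \<forall>p'\<in>A.
        g (norm (p - p')) = 1/2 * prob_space.expectation M (\<lambda>\<omega>. (Z t p \<omega> - Z t p' \<omega>)\<^sup>2))"

definition has_temporal_variogram ::
    "'w measure \<Rightarrow> (real \<Rightarrow> 'p::euclidean_space \<Rightarrow> 'w \<Rightarrow> real) \<Rightarrow> 'p set \<Rightarrow> (real \<Rightarrow> real) \<Rightarrow> bool" where
  "has_temporal_variogram M Z A g \<longleftrightarrow>
     (\<forall>p\<in>A. \<forall>t t'.
        g \<bar>t - t'\<bar> = 1/2 * prob_space.expectation M (\<lambda>\<omega>. (Z t p \<omega> - Z t' p \<omega>)\<^sup>2))"

text \<open>Bins are numbered from 1.\<close>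

definition lag_bin :: "real \<Rightarrow> nat \<Rightarrow> real set" where
  "lag_bin \<epsilon> b = {(real b - 1) * \<epsilon> ..< real b * \<epsilon>}"

text \<open>
  The \<open>i\<close>-th sample pair (\<open>i = 0, 1, \<dots>\<close>) is taken at the locations \<open>p1 i\<close>, \<open>p2 i\<close>; the pairs
  are represented by their indices, so that repeated equal measurements are counted separately.
\<close>

definition all_bin_pairs ::
    "real \<Rightarrow> (nat \<Rightarrow> 'p::euclidean_space) \<Rightarrow> (nat \<Rightarrow> 'p) \<Rightarrow> nat \<Rightarrow> nat set" where
  "all_bin_pairs \<epsilon> p1 p2 b = {i. norm (p1 i - p2 i) \<in> lag_bin \<epsilon> b}"

definition bin_pairs ::
    "real \<Rightarrow> (nat \<Rightarrow> 'p::euclidean_space) \<Rightarrow> (nat \<Rightarrow> 'p) \<Rightarrow> nat \<Rightarrow> nat \<Rightarrow> nat set" where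
  "bin_pairs \<epsilon> p1 p2 n b = {i \<in> all_bin_pairs \<epsilon> p1 p2 b. i < n}"

definition emp_semivariance :: "nat set \<Rightarrow> (nat \<Rightarrow> real) \<Rightarrow> (nat \<Rightarrow> real) \<Rightarrow> real" where
  "emp_semivariance N y1 y2 = 1 / (2 * real (card N)) * (\<Sum>i\<in>N. (y1 i - y2 i)\<^sup>2)"

definition variogram_loss ::
    "nat \<Rightarrow> (nat \<Rightarrow> real) \<Rightarrow> (real \<Rightarrow> real \<times> real \<Rightarrow> real) \<Rightarrow> (nat \<Rightarrow> real) \<Rightarrow> real \<times> real \<Rightarrow> real" where
  "variogram_loss Nb ghat \<gamma> h \<rho> = (\<Sum>b=1..Nb. (ghat b - \<gamma> (h b) \<rho>)\<^sup>2)"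

end

theory Submission
  imports Defs "HOL-Library.Discrete_Functions"
begin

text \<open>
  The variance bound makes the residuals almost surely square summable along the times at which
  a bin has received exactly \<open>m\<^sup>2\<close> pairs; the unnormalised sums have nonnegative summands, and their
  monotonicity fills the gaps since \<open>(m + 1)\<^sup>2 / m\<^sup>2 \<longlonglongrightarrow> 1\<close>.  Almost surely all empirical semivariances therefore converge,
  which forces the model variogram at the minimisers to converge to the true one; compactness and
  injectivity turn this into convergence of the minimisers.
\<close>

section \<open>Almost sure convergence from summable second moments\<close>

text \<open>By Tonelli the series of squares has a finite integral, so it is finite almost
  everywhere, and the terms of a convergent series vanish.\<close>

lemma AE_tendsto_zero_if_summable_second_moments:
  fixes X :: "nat \<Rightarrow> 'a \<Rightarrow> real"
  assumes meas: "\<And>n. X n \<in> borel_measurable M"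
    and int: "\<And>n. integrable M (\<lambda>x. (X n x)\<^sup>2)"
    and sum: "summable (\<lambda>n. \<integral>x. (X n x)\<^sup>2 \<partial>M)"
  shows "AE x in M. (\<lambda>n. X n x) \<longlonglongrightarrow> 0"
proof -
  have [measurable]: "X n \<in> borel_measurable M" for n by (rule meas)
  have "(\<integral>\<^sup>+x. (\<Sum>n. ennreal ((X n x)\<^sup>2)) \<partial>M) = (\<Sum>n. \<integral>\<^sup>+x. ennreal ((X n x)\<^sup>2) \<partial>M)"
    by (rule nn_integral_suminf) measurable
  also have "\<dots> = (\<Sum>n. ennreal (\<integral>x. (X n x)\<^sup>2 \<partial>M))"
    by (intro suminf_cong nn_integral_eq_integral int) auto
  also have "\<dots> = ennreal (\<Sum>n. \<integral>x. (X n x)\<^sup>2 \<partial>M)"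
    by (intro suminf_ennreal2 sum) auto
  finally have "(\<integral>\<^sup>+x. (\<Sum>n. ennreal ((X n x)\<^sup>2)) \<partial>M) \<noteq> \<infinity>"
    by simp
  then have "AE x in M. (\<Sum>n. ennreal ((X n x)\<^sup>2)) \<noteq> \<infinity>"
    by (intro nn_integral_PInf_AE) auto
  then show ?thesis
  proof eventually_elim
    case (elim x)
    then have "summable (\<lambda>n. (X n x)\<^sup>2)"
      by (intro summable_suminf_not_top) auto
    then have "(\<lambda>n. sqrt ((X n x)\<^sup>2)) \<longlonglongrightarrow> sqrt 0"
      by (intro tendsto_real_sqrt summable_LIMSEQ_zero)
    then show ?case
      by (simp add: tendsto_rabs_zero_iff)
  qed
qed

section \<open>Interpolation from the square counts to all times\<close>

text \<open>A counter that starts at 0 and rises by at most one per step cannot jump over a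
  value.\<close>

lemma unit_step_first_passage:
  fixes k :: "nat \<Rightarrow> nat"
  assumes "k 0 = 0" and step: "\<And>n. k (Suc n) \<le> Suc (k n)" and "filterlim k at_top sequentially"
  shows "k (LEAST n. j \<le> k n) = j"
proof -
  let ?n = "LEAST n. j \<le> k n"
  obtain n where "j \<le> k n"
    using assms(3) by (auto simp: filterlim_at_top eventually_sequentially)
  then have ge: "j \<le> k ?n" by (rule LeastI)
  show ?thesis
  proof (cases ?n)
    case 0
    then show ?thesis using ge assms(1) by simp
  next
    case (Suc l)
    then have "\<not> j \<le> k l" by (metis lessI not_less_Least)
    then show ?thesis using ge step[of l] Suc by simp
  qed
qed

text \<open>With \<open>m = floor_sqrt (k n)\<close>, time \<open>n\<close> lies between
  \<open>N m\<close> and \<open>N (Suc m)\<close>, and \<open>k n\<close> between the two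
  consecutive squares. Monotonicity of \<open>S\<close> then traps the ratio between two sequences
  with the same limit.\<close>

lemma tendsto_ratio_if_tendsto_along_squares:
  fixes S :: "nat \<Rightarrow> real" and k N :: "nat \<Rightarrow> nat"
  assumes S: "mono S" "\<And>n. S n \<ge> 0" and k: "mono k" "filterlim k at_top sequentially"
    and N: "\<And>m. k (N m) = m\<^sup>2" and N_le: "\<And>m n. m\<^sup>2 \<le> k n \<Longrightarrow> N m \<le> n"
    and lim: "(\<lambda>m. S (N m) / (real m)\<^sup>2) \<longlonglongrightarrow> L"
  shows "(\<lambda>n. S n / real (k n)) \<longlonglongrightarrow> L"
proof -
  let ?r = "\<lambda>n. floor_sqrt (k n)"
  have r: "filterlim ?r at_top sequentially"
  proof (rule filterlim_compose[OF _ k(2)])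
    show "filterlim floor_sqrt at_top sequentially"
      unfolding filterlim_at_top eventually_sequentially
      by (metis floor_sqrt_inverse_power2 mono_floor_sqrt')
  qed
  \<comment> \<open>For \<open>m > 0\<close> these are \<open>S (N m) / (Suc m)^2\<close> and
    \<open>S (N (Suc m)) / m^2\<close>: the numerator from one end, the denominator from the other.
    Each is written as a term of the known convergent sequence times a factor tending to 1.\<close>
  define lo where "lo m = S (N m) / (real m)\<^sup>2 * (real m / real (Suc m))\<^sup>2" for m
  define up where "up m = S (N (Suc m)) / (real (Suc m))\<^sup>2 * (real (Suc m) / real m)\<^sup>2" for m
  have "lo \<longlonglongrightarrow> L * 1\<^sup>2"
    unfolding lo_def by (intro tendsto_intros lim LIMSEQ_n_over_Suc_n)
  then have lo: "(\<lambda>n. lo (?r n)) \<longlonglongrightarrow> L"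
    using filterlim_compose[OF _ r, of lo "nhds L"] by simp
  have "up \<longlonglongrightarrow> L * 1\<^sup>2"
    unfolding up_def by (intro tendsto_intros LIMSEQ_Suc_n_over_n LIMSEQ_Suc[OF lim])
  then have up: "(\<lambda>n. up (?r n)) \<longlonglongrightarrow> L"
    using filterlim_compose[OF _ r, of up "nhds L"] by simp
  \<comment> \<open>Excludes \<open>m = 0\<close>, where division by zero would make the bound
    \<open>up\<close> equal to 0.\<close>
  have "\<forall>\<^sub>F n in sequentially. ?r n \<ge> 1"
    using r by (simp add: filterlim_at_top)
  then have bounds: "\<forall>\<^sub>F n in sequentially. lo (?r n) \<le> S n / real (k n) \<and> S n / real (k n) \<le> up (?r n)"
  proof eventually_elim
    case (elim n)
    let ?m = "?r n"
    have m: "?m\<^sup>2 \<le> k n" "k n < (Suc ?m)\<^sup>2"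
      by (simp_all add: Suc_floor_sqrt_power2_gt)
    then have m': "(real ?m)\<^sup>2 \<le> real (k n)" "real (k n) \<le> (real (Suc ?m))\<^sup>2"
      by (metis of_nat_le_iff of_nat_power, metis less_imp_le of_nat_le_iff of_nat_power)
    have pos: "real ?m > 0" using elim by linarith
    \<comment> \<open>Otherwise monotonicity of \<open>k\<close> would give
      \<open>(Suc ?m)^2 \<le> k n\<close>, against the choice of \<open>?m\<close>.\<close>
    have "\<not> N (Suc ?m) \<le> n"
      using monoD[OF k(1), of "N (Suc ?m)" n] m(2) N[of "Suc ?m"] by auto
    then have "S n \<le> S (N (Suc ?m))"
      by (intro monoD[OF S(1)]) simp
    then have "S n / real (k n) \<le> S (N (Suc ?m)) / (real ?m)\<^sup>2"
      using m' pos S(2) by (intro frac_le) auto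
    also have "\<dots> = up ?m"
      by (simp add: up_def power_divide del: of_nat_Suc)
    finally have "S n / real (k n) \<le> up ?m" .
    have "lo ?m = S (N ?m) / (real (Suc ?m))\<^sup>2"
      using pos by (simp add: lo_def power_divide del: of_nat_Suc)
    also have "\<dots> \<le> S n / real (k n)"
    proof (rule frac_le)
      show "0 < real (k n)" using m' pos by (smt (verit) zero_less_power)
    qed (use m' N_le[OF m(1)] S in \<open>auto intro: monoD\<close>)
    finally show ?case using \<open>S n / real (k n) \<le> up ?m\<close> by simp
  qed
  show ?thesis
    by (rule tendsto_sandwich[OF _ _ lo up]) (use bounds in \<open>auto elim: eventually_mono\<close>)
qed

section \<open>Deterministic consistency of the minimisers\<close>

text \<open>On the compact set of points of \<open>K\<close> outside a ball about \<open>a\<close>,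
  \<open>g\<close> has a positive minimum; once \<open>g (x n)\<close> falls below it,
  \<open>x n\<close> must be in the ball.\<close>

lemma tendsto_unique_zero_compact:
  fixes g :: "'a::metric_space \<Rightarrow> real"
  assumes "compact K" "continuous_on K g" and pos: "\<And>x. x \<in> K \<Longrightarrow> x \<noteq> a \<Longrightarrow> g x > 0"
    and K: "\<forall>\<^sub>F n in F. x n \<in> K" and lim: "((\<lambda>n. g (x n)) \<longlongrightarrow> 0) F"
  shows "(x \<longlongrightarrow> a) F"
proof (rule tendstoI)
  fix e :: real assume "e > 0"
  have c: "compact (K - ball a e)"
    using \<open>compact K\<close> by (intro compact_diff) auto
  show "\<forall>\<^sub>F n in F. dist (x n) a < e"
  \<comment> \<open>A minimum exists only on a nonempty set; if the ball covers \<open>K\<close>,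
    membership in \<open>K\<close> is already enough.\<close>
  proof (cases "K - ball a e = {}")
    case True
    show ?thesis using K by eventually_elim (use True in \<open>auto simp: dist_commute\<close>)
  next
    case False
    obtain z where z: "z \<in> K - ball a e" "\<forall>y\<in>K - ball a e. g z \<le> g y"
      using continuous_attains_inf[OF c False continuous_on_subset[OF assms(2)]] by auto
    then have "g z > 0" using pos[of z] \<open>e > 0\<close> by (cases "z = a") auto
    then have "\<forall>\<^sub>F n in F. g (x n) < g z" by (rule order_tendstoD(2)[OF lim])
    with K show ?thesis
    proof eventually_elim
      case (elim n)
      then show ?case using z(2) by (force simp: dist_commute)
    qed
  qed
qed

text \<open>The limiting loss \<open>?d\<close> vanishes on \<open>\<Lambda>\<close> only at
  \<open>\<rho>\<close>, by injectivity. Comparing the minimiser with the competitor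
  \<open>\<rho>\<close> bounds \<open>?d (x n)\<close> by a multiple of the empirical loss at
  \<open>\<rho>\<close>, which tends to 0; so pointwise convergence of \<open>g\<close> in each bin
  suffices.\<close>

lemma variogram_minimisers_tendsto:
  assumes "compact \<Lambda>" and cont: "\<And>b. b \<in> {1..Nb} \<Longrightarrow> continuous_on \<Lambda> (\<gamma> (h b))"
    and inj: "inj_on (\<lambda>\<rho>. \<lambda>b\<in>{1..Nb}. \<gamma> (h b) \<rho>) \<Lambda>" and true: "\<rho> \<in> \<Lambda>"
    and lim: "\<And>b. b \<in> {1..Nb} \<Longrightarrow> (\<lambda>n. g n b) \<longlonglongrightarrow> \<gamma> (h b) \<rho>"
    and argmin: "\<forall>\<^sub>F n in sequentially.
      is_arg_min (variogram_loss Nb (g n) \<gamma> h) (\<lambda>\<rho>. \<rho> \<in> \<Lambda>) (x n)"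
  shows "x \<longlonglongrightarrow> \<rho>"
proof (rule tendsto_unique_zero_compact[OF \<open>compact \<Lambda>\<close>])
  let ?L = "\<lambda>n. variogram_loss Nb (g n) \<gamma> h"
  let ?d = "variogram_loss Nb (\<lambda>b. \<gamma> (h b) \<rho>) \<gamma> h"
  show "continuous_on \<Lambda> ?d"
    unfolding variogram_loss_def by (intro continuous_intros cont)
  show "?d \<rho>' > 0" if "\<rho>' \<in> \<Lambda>" "\<rho>' \<noteq> \<rho>" for \<rho>'
  proof -
    have "(\<lambda>b\<in>{1..Nb}. \<gamma> (h b) \<rho>) \<noteq> (\<lambda>b\<in>{1..Nb}. \<gamma> (h b) \<rho>')"
      using inj_onD[OF inj] true that by metis
    then obtain b where "b \<in> {1..Nb}" "\<gamma> (h b) \<rho> \<noteq> \<gamma> (h b) \<rho>'"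
      by (auto simp: restrict_def fun_eq_iff split: if_splits)
    then show ?thesis
      unfolding variogram_loss_def by (intro sum_pos2[of _ b]) auto
  qed
  show "\<forall>\<^sub>F n in sequentially. x n \<in> \<Lambda>"
    using argmin by eventually_elim (simp add: is_arg_min_def)
  have "(\<lambda>n. \<Sum>b=1..Nb. (g n b - \<gamma> (h b) \<rho>)\<^sup>2) \<longlonglongrightarrow> (\<Sum>b=1..Nb. (\<gamma> (h b) \<rho> - \<gamma> (h b) \<rho>)\<^sup>2)"
    by (intro tendsto_intros lim)
  then have L0: "(\<lambda>n. 4 * ?L n \<rho>) \<longlonglongrightarrow> 0"
    using tendsto_mult_right_zero[of _ _ 4] by (simp add: variogram_loss_def)
  \<comment> \<open>The factor 4 is 2 + 2: the squared triangle inequality gives twice the loss at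
    \<open>\<rho>\<close> plus twice the loss at \<open>x n\<close>, and minimality bounds the
    latter loss by the former.\<close>
  have "\<forall>\<^sub>F n in sequentially. ?d (x n) \<le> 4 * ?L n \<rho>"
    using argmin
  proof eventually_elim
    case (elim n)
    have "?d (x n) \<le> 2 * ?L n \<rho> + 2 * ?L n (x n)"
      unfolding variogram_loss_def sum_distrib_left sum.distrib[symmetric]
    proof (rule sum_mono)
      fix b
      \<comment> \<open>The right side minus the left side is the square of
        \<open>(w - u) + (w - v)\<close>.\<close>
      have "(u - v)\<^sup>2 \<le> 2 * (w - u)\<^sup>2 + 2 * (w - v)\<^sup>2" for u v w :: real
        using zero_le_power2[of "(w - u) + (w - v)"] by (simp add: power2_eq_square algebra_simps)
      then show "(\<gamma> (h b) \<rho> - \<gamma> (h b) (x n))\<^sup>2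
          \<le> 2 * (g n b - \<gamma> (h b) \<rho>)\<^sup>2 + 2 * (g n b - \<gamma> (h b) (x n))\<^sup>2" .
    qed
    moreover have "?L n (x n) \<le> ?L n \<rho>"
      using elim true not_le unfolding is_arg_min_def by blast
    ultimately show ?case by simp
  qed
  moreover have "\<forall>n. 0 \<le> ?d (x n)" by (simp add: variogram_loss_def sum_nonneg)
  ultimately show "(\<lambda>n. ?d (x n)) \<longlonglongrightarrow> 0"
    by (intro tendsto_sandwich[OF _ _ tendsto_const L0]) auto
qed

section \<open>Almost sure convergence of the semivariance in one bin\<close>

lemma card_bin_pairs_Suc_le: "card (bin_pairs \<epsilon> p1 p2 (Suc n) b) \<le> Suc (card (bin_pairs \<epsilon> p1 p2 n b))"
proof -
  have fin: "finite (bin_pairs \<epsilon> p1 p2 n b)" by (simp add: bin_pairs_def)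
  have "bin_pairs \<epsilon> p1 p2 (Suc n) b \<subseteq> insert n (bin_pairs \<epsilon> p1 p2 n b)"
    by (auto simp: bin_pairs_def less_Suc_eq)
  then have "card (bin_pairs \<epsilon> p1 p2 (Suc n) b) \<le> card (insert n (bin_pairs \<epsilon> p1 p2 n b))"
    using fin by (intro card_mono) auto
  also have "\<dots> \<le> Suc (card (bin_pairs \<epsilon> p1 p2 n b))" using fin by (simp add: card_insert_if)
  finally show ?thesis .
qed

text \<open>At the first time the bin holds \<open>(Suc m)^2\<close> pairs, the second moment of the
  residual is of order \<open>1 / (Suc m)^2\<close>, which is summable. The residual is constrained
  only while the bin is nonempty, since an empty bin makes the semivariance 0 by division by
  zero.\<close>

lemma AE_emp_semivariance_tendsto:
  fixes M :: "'w measure" and p1 p2 :: "nat \<Rightarrow> 'p::euclidean_space"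
    and y1 y2 :: "nat \<Rightarrow> 'w \<Rightarrow> real" and res :: "nat \<Rightarrow> 'w \<Rightarrow> real" and \<epsilon> L :: real and b :: nat
  defines "k \<equiv> \<lambda>n. card (bin_pairs \<epsilon> p1 p2 n b)"
    and "g \<equiv> \<lambda>n \<omega>. emp_semivariance (bin_pairs \<epsilon> p1 p2 n b) (\<lambda>i. y1 i \<omega>) (\<lambda>i. y2 i \<omega>)"
  assumes residual: "\<And>n \<omega>. k n > 0 \<Longrightarrow> \<omega> \<in> space M \<Longrightarrow> g n \<omega> = L + res n \<omega>"
    and meas: "\<And>n. k n > 0 \<Longrightarrow> res n \<in> borel_measurable M"
    and int: "\<And>n. k n > 0 \<Longrightarrow> integrable M (\<lambda>\<omega>. (res n \<omega>)\<^sup>2)"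
    and var: "(\<lambda>n. \<integral>\<omega>. (res n \<omega>)\<^sup>2 \<partial>M) \<in> O(\<lambda>n. 1 / real (k n))"
    and k_infinity: "filterlim k at_top sequentially"
  shows "AE \<omega> in M. (\<lambda>n. g n \<omega>) \<longlonglongrightarrow> L"
proof -
  define N where "N m = (LEAST n. m\<^sup>2 \<le> k n)" for m
  have fin: "finite (bin_pairs \<epsilon> p1 p2 n b)" for n by (simp add: bin_pairs_def)
  have sub: "bin_pairs \<epsilon> p1 p2 n b \<subseteq> bin_pairs \<epsilon> p1 p2 n' b" if "n \<le> n'" for n n'
    using that by (auto simp: bin_pairs_def)
  have mono_k: "mono k"
    unfolding k_def by (intro monoI card_mono fin sub)
  have kN: "k (N m) = m\<^sup>2" for m
    unfolding N_def
  proof (rule unit_step_first_passage[OF _ _ k_infinity])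
    show "k 0 = 0" by (simp add: k_def bin_pairs_def)
    show "k (Suc n) \<le> Suc (k n)" for n unfolding k_def by (rule card_bin_pairs_Suc_le)
  qed
  have N_le: "N m \<le> n" if "m\<^sup>2 \<le> k n" for m n
    unfolding N_def using that by (rule Least_le)
  \<comment> \<open>At most one pair arrives per step, so \<open>m^2\<close> pairs take at least
    \<open>m^2\<close> steps. Hence \<open>N\<close> tends to infinity and the O-bound can be
    evaluated along it.\<close>
  have N_ge: "m \<le> N m" for m
  proof -
    have "k (N m) \<le> card {..<N m}"
      unfolding k_def by (intro card_mono) (auto simp: bin_pairs_def)
    then have "m\<^sup>2 \<le> N m" using kN by simp
    then show ?thesis by (rule power2_nat_le_imp_le)
  qed
  \<comment> \<open>The shift to \<open>Suc m\<close> avoids \<open>N 0\<close>, where the bin is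
    empty.\<close>
  have "filterlim (\<lambda>m. N (Suc m)) at_top sequentially"
    by (rule filterlim_at_top_mono[OF filterlim_Suc]) (simp add: N_ge)
  then have "(\<lambda>m. \<integral>\<omega>. (res (N (Suc m)) \<omega>)\<^sup>2 \<partial>M) \<in> O(\<lambda>m. 1 / real (k (N (Suc m))))"
    by (rule landau_o.big.compose[OF var])
  then have "(\<lambda>m. \<integral>\<omega>. (res (N (Suc m)) \<omega>)\<^sup>2 \<partial>M) \<in> O(\<lambda>m. 1 / (real (Suc m))\<^sup>2)"
    by (simp only: kN of_nat_power)
  moreover have "summable (\<lambda>m. norm (1 / (real (Suc m))\<^sup>2))"
    using summable_Suc_iff[THEN iffD2, OF inverse_power_summable[of 2, where 'a = real]]
    by (simp add: inverse_eq_divide del: of_nat_Suc)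
  ultimately have "summable (\<lambda>m. \<integral>\<omega>. (res (N (Suc m)) \<omega>)\<^sup>2 \<partial>M)"
    by (rule summable_comparison_test_bigo[rotated])
  then have "AE \<omega> in M. (\<lambda>m. res (N (Suc m)) \<omega>) \<longlonglongrightarrow> 0"
    by (intro AE_tendsto_zero_if_summable_second_moments meas int) (simp_all add: kN)
  then show ?thesis
    using AE_space
  proof eventually_elim
    case (elim \<omega>)
    \<comment> \<open>Dropping the normalisation makes the sum nondecreasing in \<open>n\<close>,
      which the semivariance itself need not be. The identity \<open>g\<close> below also covers
      \<open>k n = 0\<close>, where both sides are 0.\<close>
    define S where "S n = 1/2 * (\<Sum>i\<in>bin_pairs \<epsilon> p1 p2 n b. (y1 i \<omega> - y2 i \<omega>)\<^sup>2)" for n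
    have g: "g n \<omega> = S n / real (k n)" for n
      by (simp add: g_def S_def k_def emp_semivariance_def)
    have eq: "L + res (N (Suc m)) \<omega> = S (N (Suc m)) / (real (Suc m))\<^sup>2" for m
    proof -
      have "k (N (Suc m)) > 0" by (simp add: kN)
      then show ?thesis using residual[OF _ elim(2)] by (metis g kN of_nat_power)
    qed
    have "(\<lambda>m. L + res (N (Suc m)) \<omega>) \<longlonglongrightarrow> L + 0"
      by (intro tendsto_intros elim(1))
    then have "(\<lambda>m. S (N (Suc m)) / (real (Suc m))\<^sup>2) \<longlonglongrightarrow> L"
      by (simp only: eq add_0_right)
    then have lim: "(\<lambda>m. S (N m) / (real m)\<^sup>2) \<longlonglongrightarrow> L"
      by (rule LIMSEQ_imp_Suc)
    have "mono S"
      unfolding S_def by (intro monoI mult_left_mono sum_mono2 fin sub) auto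
    moreover have "S n \<ge> 0" for n by (simp add: S_def sum_nonneg)
    ultimately show ?case
      unfolding g
      by (rule tendsto_ratio_if_tendsto_along_squares[OF _ _ mono_k k_infinity kN N_le lim])
  qed
qed

section \<open>Almost sure consistency of the variogram fit\<close>

theorem theorem1:
  fixes M :: "'w measure"
    and Z :: "real \<Rightarrow> 'p::euclidean_space \<Rightarrow> 'w \<Rightarrow> real"
    and A :: "'p set"
    and \<gamma> :: "real \<Rightarrow> real \<times> real \<Rightarrow> real"
    and gam_t :: "real \<Rightarrow> real \<times> real \<Rightarrow> real"
    and \<Lambda> :: "(real \<times> real) set"
    and sig_star lam_star sig_t lam_t :: real
    and \<epsilon> :: real
    and Nb :: nat
    and h :: "nat \<Rightarrow> real"
    and \<tau> :: "nat \<Rightarrow> real"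
    and p1 p2 :: "nat \<Rightarrow> 'p"
    and y1 y2 :: "nat \<Rightarrow> 'w \<Rightarrow> real"
    and nb :: "nat \<Rightarrow> nat \<Rightarrow> nat"
    and ghat :: "nat \<Rightarrow> nat \<Rightarrow> 'w \<Rightarrow> real"
    and res :: "nat \<Rightarrow> nat \<Rightarrow> 'w \<Rightarrow> real"
    and c :: "nat \<Rightarrow> real"
    and sig_hat lam_hat :: "nat \<Rightarrow> 'w \<Rightarrow> real"
  assumes prob: "prob_space M"
    and stationary: "second_order_stationary M Z A"
    and spatial: "has_spatial_variogram M Z A (\<lambda>d. \<gamma> d (sig_star, lam_star))"
    and temporal: "has_temporal_variogram M Z A (\<lambda>s. gam_t s (sig_t, lam_t))"
    and true_param: "(sig_star, lam_star) \<in> \<Lambda>"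
    and diff: "\<And>d. d \<ge> 0 \<Longrightarrow> (\<lambda>\<rho>. \<gamma> d \<rho>) differentiable_on \<Lambda>"
    and width: "\<epsilon> > 0"
    and rep: "\<And>b. b \<in> {1..Nb} \<Longrightarrow> h b \<in> lag_bin \<epsilon> b"
    and loc: "\<And>i. p1 i \<in> A" "\<And>i. p2 i \<in> A"
    and y1: "\<And>i \<omega>. \<omega> \<in> space M \<Longrightarrow> y1 i \<omega> = Z (\<tau> i) (p1 i) \<omega>"
    and y2: "\<And>i \<omega>. \<omega> \<in> space M \<Longrightarrow> y2 i \<omega> = Z (\<tau> i) (p2 i) \<omega>"
    and nb: "\<And>n b. nb n b = card (bin_pairs \<epsilon> p1 p2 n b)"
    and ghat: "\<And>n b \<omega>. \<omega> \<in> space M \<Longrightarrow>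
      ghat n b \<omega> = emp_semivariance (bin_pairs \<epsilon> p1 p2 n b) (\<lambda>i. y1 i \<omega>) (\<lambda>i. y2 i \<omega>)"
    and argmin: "\<And>n \<omega>. \<omega> \<in> space M \<Longrightarrow> (\<forall>b\<in>{1..Nb}. nb n b > 0) \<Longrightarrow>
      is_arg_min (variogram_loss Nb (\<lambda>b. ghat n b \<omega>) \<gamma> h) (\<lambda>\<rho>. \<rho> \<in> \<Lambda>) (sig_hat n \<omega>, lam_hat n \<omega>)"
    and residual: "\<And>n b \<omega>. b \<in> {1..Nb} \<Longrightarrow> nb n b > 0 \<Longrightarrow> \<omega> \<in> space M \<Longrightarrow>
      ghat n b \<omega> = \<gamma> (h b) (sig_star, lam_star) + res n b \<omega>"
    and res_mean: "\<And>n b. b \<in> {1..Nb} \<Longrightarrow> nb n b > 0 \<Longrightarrow>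
      integrable M (res n b) \<and> prob_space.expectation M (res n b) = 0"
    and res_var_finite: "\<And>n b. b \<in> {1..Nb} \<Longrightarrow> nb n b > 0 \<Longrightarrow>
      integrable M (\<lambda>\<omega>. (res n b \<omega>)\<^sup>2)"
    and bias: "\<And>b. b \<in> {1..Nb} \<Longrightarrow>
      (\<lambda>n. prob_space.expectation M (ghat n b) - \<gamma> (h b) (sig_star, lam_star))
        \<in> O(\<lambda>n. 1 / real (nb n b))"
    and res_var: "\<And>b. b \<in> {1..Nb} \<Longrightarrow>
      (\<lambda>n. prob_space.variance M (res n b)) \<in> O(\<lambda>n. 1 / real (nb n b))"
    and nb_infinity: "\<And>b. b \<in> {1..Nb} \<Longrightarrow> filterlim (\<lambda>n. nb n b) at_top sequentially"
    and c_pos: "\<And>b. b \<in> {1..Nb} \<Longrightarrow> c b > 0"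
    and nb_rate: "\<And>b. b \<in> {1..Nb} \<Longrightarrow> (\<lambda>n. real (nb n b) / real n) \<longlonglongrightarrow> c b"
    and compact: "compact \<Lambda>"
    and injective: "inj_on (\<lambda>\<rho>. \<lambda>b\<in>{1..Nb}. \<gamma> (h b) \<rho>) \<Lambda>"
    and uncorrelated: "\<And>n b b'. b \<in> {1..Nb} \<Longrightarrow> b' \<in> {1..Nb} \<Longrightarrow> b \<noteq> b' \<Longrightarrow>
      nb n b > 0 \<Longrightarrow> nb n b' > 0 \<Longrightarrow> covariance M (res n b) (res n b') = 0"
    and indep: "\<And>b. b \<in> {1..Nb} \<Longrightarrow>
      prob_space.indep_vars M (\<lambda>_. borel :: (real \<times> real) measure)
        (\<lambda>i \<omega>. (y1 i \<omega>, y2 i \<omega>)) (all_bin_pairs \<epsilon> p1 p2 b)"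
  shows "(AE \<omega> in M. (\<lambda>n. (sig_hat n \<omega>, lam_hat n \<omega>)) \<longlonglongrightarrow> (sig_star, lam_star))
       \<and> (AE \<omega> in M. (\<lambda>n. lam_hat n \<omega>) \<longlonglongrightarrow> lam_star)"
proof -
  have "AE \<omega> in M. \<forall>b\<in>{1..Nb}. (\<lambda>n. ghat n b \<omega>) \<longlonglongrightarrow> \<gamma> (h b) (sig_star, lam_star)"
  proof (rule AE_finite_allI)
    fix b assume b: "b \<in> {1..Nb}"
    have pos: "\<forall>\<^sub>F n in sequentially. nb n b > 0"
      using eventually_gt_at_top nb_infinity[OF b] by (rule eventually_compose_filterlim)
    \<comment> \<open>The residuals are centred once the bin is nonempty, so variance and second
      moment eventually agree, which is all a Landau class sees.\<close>
    have "\<forall>\<^sub>F n in sequentially. prob_space.variance M (res n b) = (\<integral>\<omega>. (res n b \<omega>)\<^sup>2 \<partial>M)"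
      using pos by eventually_elim (simp add: res_mean[OF b])
    then have "(\<lambda>n. \<integral>\<omega>. (res n b \<omega>)\<^sup>2 \<partial>M) \<in> O(\<lambda>n. 1 / real (nb n b))"
      using res_var[OF b] landau_o.big.in_cong by fastforce
    then have "AE \<omega> in M. (\<lambda>n. emp_semivariance (bin_pairs \<epsilon> p1 p2 n b) (\<lambda>i. y1 i \<omega>) (\<lambda>i. y2 i \<omega>))
        \<longlonglongrightarrow> \<gamma> (h b) (sig_star, lam_star)"
      using res_mean[OF b] res_var_finite[OF b] nb_infinity[OF b] residual[OF b]
      by (intro AE_emp_semivariance_tendsto[where res = "\<lambda>n. res n b"]) (auto simp: nb ghat)
    then show "AE \<omega> in M. (\<lambda>n. ghat n b \<omega>) \<longlonglongrightarrow> \<gamma> (h b) (sig_star, lam_star)"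
      using AE_space by eventually_elim (simp add: ghat)
  qed simp
  \<comment> \<open>From here the argument is pathwise: fix an outcome at which all of the finitely
    many bins converge and apply the deterministic result.\<close>
  then have *: "AE \<omega> in M. (\<lambda>n. (sig_hat n \<omega>, lam_hat n \<omega>)) \<longlonglongrightarrow> (sig_star, lam_star)"
    using AE_space
  proof eventually_elim
    case (elim \<omega>)
    have "continuous_on \<Lambda> (\<gamma> (h b))" if b: "b \<in> {1..Nb}" for b
    proof -
      \<comment> \<open>Bins are numbered from 1, so every representative lag is nonnegative, the
        range in which \<open>\<gamma>\<close> is differentiable in the parameters.\<close>
      have "0 \<le> (real b - 1) * \<epsilon>" using b width by simp
      then have "h b \<ge> 0" using rep[OF b] unfolding lag_bin_def by simp
      then show ?thesis using diff differentiable_imp_continuous_on by blast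
    qed
    \<comment> \<open>The minimising property is available only when every bin is nonempty; with
      finitely many bins this holds from some \<open>n\<close> on.\<close>
    moreover have "\<forall>\<^sub>F n in sequentially. \<forall>b\<in>{1..Nb}. nb n b > 0"
      using nb_infinity by (intro eventually_ball_finite) (auto intro: eventually_compose_filterlim[OF eventually_gt_at_top])
    then have "\<forall>\<^sub>F n in sequentially.
        is_arg_min (variogram_loss Nb (\<lambda>b. ghat n b \<omega>) \<gamma> h) (\<lambda>\<rho>. \<rho> \<in> \<Lambda>) (sig_hat n \<omega>, lam_hat n \<omega>)"
      by eventually_elim (use elim(2) argmin in blast)
    ultimately show ?case
      using elim(1) by (intro variogram_minimisers_tendsto[OF compact _ injective true_param]) auto
  qed
  moreover from * have "AE \<omega> in M. (\<lambda>n. lam_hat n \<omega>) \<longlonglongrightarrow> lam_star"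
    by eventually_elim (auto dest: tendsto_snd)
  ultimately show ?thesis ..
qed

end
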